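(* The equation $xy^2 = y^2x$ (in the two free variables $x,y$) has finite satisfiability gap $\varepsilon = \frac{1}{8}$. That is, for every finite group $G$, either $\mathrm{ds}_G(xy^2=y^2x) = 1$ or $\mathrm{ds}_G(xy^2=y^2x) \leq 1 - \frac{1}{8}$.
   Context: For an equation $\varphi$ in the first-order language of group theory with $n$ free variables and a finite group $G$, the degree of satisfiability of $\varphi$ in $G$ is $\mathrm{ds}_G(\varphi) = \frac{|\{\overline{x} \in G^n : \varphi(\overline{x})\}|}{|G^n|}$. The equation $\varphi$ has finite satisfiability gap $\varepsilon > 0$ if for every finite group $G$ either $\mathrm{ds}_G(\varphi) = 1$ or $\mathrm{ds}_G(\varphi) \leq 1-\varepsilon$. *)

theory Defs
  imports Complex_Main "HOL-Library.FuncSet" "HOL-Algebra.Group"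
begin

datatype grp_term =
    Var nat
  | One
  | Mul grp_term grp_term
  | Inv grp_term

datatype grp_eqn = Eqn grp_term grp_term

primrec term_vars :: "grp_term \<Rightarrow> nat set" where
  "term_vars (Var i) = {i}"
| "term_vars One = {}"
| "term_vars (Mul s t) = term_vars s \<union> term_vars t"
| "term_vars (Inv t) = term_vars t"

primrec free_vars :: "grp_eqn \<Rightarrow> nat set" where
  "free_vars (Eqn s t) = term_vars s \<union> term_vars t"

primrec term_val :: "('a, 'b) monoid_scheme \<Rightarrow> (nat \<Rightarrow> 'a) \<Rightarrow> grp_term \<Rightarrow> 'a" where
  "term_val G v (Var i) = v i"
| "term_val G v One = \<one>\<^bsub>G\<^esub>"
| "term_val G v (Mul s t) = term_val G v s \<otimes>\<^bsub>G\<^esub> term_val G v t"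
| "term_val G v (Inv t) = inv\<^bsub>G\<^esub> term_val G v t"

primrec satisfies :: "('a, 'b) monoid_scheme \<Rightarrow> (nat \<Rightarrow> 'a) \<Rightarrow> grp_eqn \<Rightarrow> bool" where
  "satisfies G v (Eqn s t) \<longleftrightarrow> term_val G v s = term_val G v t"

text \<open>An \<open>n\<close>-tuple over \<open>G\<close> is represented by an extensional function from the
  \<open>n\<close> free variables of the equation to the carrier.\<close>

definition assignments :: "('a, 'b) monoid_scheme \<Rightarrow> grp_eqn \<Rightarrow> (nat \<Rightarrow> 'a) set" where
  "assignments G \<phi> = (free_vars \<phi> \<rightarrow>\<^sub>E carrier G)"

definition degree_of_satisfiability :: "('a, 'b) monoid_scheme \<Rightarrow> grp_eqn \<Rightarrow> real" where
  "degree_of_satisfiability G \<phi> =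
     real (card {v \<in> assignments G \<phi>. satisfies G v \<phi>}) / real (card (assignments G \<phi>))"

text \<open>HOL cannot quantify over types inside a formula, so the groups range over those whose
  elements are drawn from the type \<open>'a\<close>. A theorem asserting this predicate with \<open>'a\<close>
  left as a type variable speaks about all finite groups.\<close>

definition finite_satisfiability_gap :: "'a itself \<Rightarrow> grp_eqn \<Rightarrow> real \<Rightarrow> bool" where
  "finite_satisfiability_gap (_ :: 'a itself) \<phi> \<epsilon> \<longleftrightarrow>
     \<epsilon> > 0 \<and>
     (\<forall>G :: 'a monoid. group G \<longrightarrow> finite (carrier G) \<longrightarrow>
        degree_of_satisfiability G \<phi> = 1 \<or> degree_of_satisfiability G \<phi> \<le> 1 - \<epsilon>)"

definition commutes_with_square_eqn :: grp_eqn where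
  "commutes_with_square_eqn =
     (let x = Var 0; y = Var 1 in Eqn (Mul x (Mul y y)) (Mul (Mul y y) x))"

end

theory Submission
  imports Defs "HOL-Algebra.Group_Action"
begin

text \<open>
  Write \<open>S\<close> for the set of those \<open>y\<close> whose square is central. If \<open>y \<in> S\<close>, every \<open>x\<close> commutes
  with \<open>y\<^sup>2\<close>; otherwise the centralizer of \<open>y\<^sup>2\<close> is a proper subgroup, so by Lagrange at most half
  of all \<open>x\<close> commute with it. With \<open>p = |S| / |G|\<close> the degree of satisfiability is therefore at
  most \<open>p + (1 - p) / 2 = (1 + p) / 2\<close>, and this is at most \<open>7/8\<close> as soon as \<open>p \<le> 3/4\<close>.

  The remaining point is that \<open>p > 3/4\<close> forces \<open>S = G\<close>. Modulo the center, \<open>S\<close> becomes the set of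
  elements of square one, and a finite group in which more than three quarters of the elements
  have square one is elementary abelian: if \<open>a\<^sup>2 = 1\<close>, then \<open>b\<^sup>2 = (a b)\<^sup>2 = 1\<close> for more than half
  of all \<open>b\<close>, and each such \<open>b\<close> commutes with \<open>a\<close>, so \<open>a\<close> is central; hence the center contains
  more than half of the group and so everything, the group is abelian, and then the elements of square one form a
  subgroup that again contains more than half of the group. The argument is carried out for
  the elements whose square lies in the kernel of a homomorphism
  (\<open>square_in_kernel_if_more_than_three_quarters\<close>), and applied to the conjugation action,
  whose kernel is the center (\<open>conjugation_eq_one_iff\<close>).
\<close>

section \<open>Subgroups that contain more than half of a group\<close>

lemma (in group) subgroup_eq_carrier_if_more_than_half:
  assumes "subgroup H G" and "finite (carrier G)" and "2 * card H > order G"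
  shows "H = carrier G"
proof -
  have "card (rcosets H) * card H = order G"
    by (rule lagrange[OF assms(1)])
  moreover from this have "card (rcosets H) < 2"
    using assms(3) by (metis mult_le_mono1 not_le)
  moreover have "order G > 0"
    using assms(2) order_gt_0_iff_finite by simp
  ultimately have "card H = order G"
    by (cases "card (rcosets H)") auto
  with assms show ?thesis
    by (simp add: card_subset_eq order_def subgroup.subset)
qed

lemma (in group_hom) subgroup_commuting_image:
  assumes x: "x \<in> carrier G"
  shows "subgroup {g \<in> carrier G. h x \<otimes>\<^bsub>H\<^esub> h g = h g \<otimes>\<^bsub>H\<^esub> h x} G"
proof (rule G.subgroupI)
  show "inv a \<in> {g \<in> carrier G. h x \<otimes>\<^bsub>H\<^esub> h g = h g \<otimes>\<^bsub>H\<^esub> h x}"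
    if "a \<in> {g \<in> carrier G. h x \<otimes>\<^bsub>H\<^esub> h g = h g \<otimes>\<^bsub>H\<^esub> h x}" for a
  proof -
    have a: "a \<in> carrier G" and comm: "h x \<otimes>\<^bsub>H\<^esub> h a = h a \<otimes>\<^bsub>H\<^esub> h x"
      using that by auto
    have "h a \<otimes>\<^bsub>H\<^esub> (h x \<otimes>\<^bsub>H\<^esub> inv\<^bsub>H\<^esub> h a) = h x \<otimes>\<^bsub>H\<^esub> h a \<otimes>\<^bsub>H\<^esub> inv\<^bsub>H\<^esub> h a"
      using a x comm by (simp add: H.m_assoc)
    also have "\<dots> = h x"
      using a x by (simp add: H.m_assoc)
    finally have "h x \<otimes>\<^bsub>H\<^esub> inv\<^bsub>H\<^esub> h a = inv\<^bsub>H\<^esub> h a \<otimes>\<^bsub>H\<^esub> h x"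
      using a x by (intro H.inv_solve_left[THEN iffD2]) auto
    with a show ?thesis by simp
  qed
  show "a \<otimes> b \<in> {g \<in> carrier G. h x \<otimes>\<^bsub>H\<^esub> h g = h g \<otimes>\<^bsub>H\<^esub> h x}"
    if "a \<in> {g \<in> carrier G. h x \<otimes>\<^bsub>H\<^esub> h g = h g \<otimes>\<^bsub>H\<^esub> h x}"
      and "b \<in> {g \<in> carrier G. h x \<otimes>\<^bsub>H\<^esub> h g = h g \<otimes>\<^bsub>H\<^esub> h x}" for a b
  proof -
    have a: "a \<in> carrier G" "h x \<otimes>\<^bsub>H\<^esub> h a = h a \<otimes>\<^bsub>H\<^esub> h x"
      and b: "b \<in> carrier G" "h x \<otimes>\<^bsub>H\<^esub> h b = h b \<otimes>\<^bsub>H\<^esub> h x"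
      using that by auto
    have "h x \<otimes>\<^bsub>H\<^esub> h (a \<otimes> b) = h x \<otimes>\<^bsub>H\<^esub> h a \<otimes>\<^bsub>H\<^esub> h b"
      using a(1) b(1) x by (simp add: H.m_assoc)
    also have "\<dots> = h a \<otimes>\<^bsub>H\<^esub> (h x \<otimes>\<^bsub>H\<^esub> h b)"
      using a b(1) x by (simp add: H.m_assoc)
    also have "\<dots> = h (a \<otimes> b) \<otimes>\<^bsub>H\<^esub> h x"
      using a(1) b x by (simp add: H.m_assoc)
    finally show ?thesis
      using a(1) b(1) by simp
  qed
  show "{g \<in> carrier G. h x \<otimes>\<^bsub>H\<^esub> h g = h g \<otimes>\<^bsub>H\<^esub> h x} \<noteq> {}"
    using x by auto
qed auto

lemma (in group) card_centralizer_le_half: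
  assumes fin: "finite (carrier G)" and z: "z \<in> carrier G"
    and noncentral: "\<exists>x \<in> carrier G. x \<otimes> z \<noteq> z \<otimes> x"
  shows "2 * card {x \<in> carrier G. x \<otimes> z = z \<otimes> x} \<le> order G"
proof -
  interpret id: group_hom G G id
    by unfold_locales (auto simp: hom_def)
  have "subgroup {x \<in> carrier G. x \<otimes> z = z \<otimes> x} G"
    using id.subgroup_commuting_image[OF z] by (simp add: eq_commute)
  from subgroup_eq_carrier_if_more_than_half[OF this fin] noncentral show ?thesis
    by (cases "order G < 2 * card {x \<in> carrier G. x \<otimes> z = z \<otimes> x}") auto
qed

section \<open>Homomorphisms for which most squares lie in the kernel\<close>

text \<open>Two elements \<open>a\<close>, \<open>b\<close> with \<open>a\<^sup>2 = b\<^sup>2 = (a b)\<^sup>2 = 1\<close> commute, because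
  \<open>a b = (a b)\<^sup>-\<^sup>1 = b\<^sup>-\<^sup>1 a\<^sup>-\<^sup>1 = b a\<close>.\<close>

lemma (in group) commute_if_squares_eq_one:
  assumes "a \<in> carrier G" "b \<in> carrier G"
    and "a \<otimes> a = \<one>" "b \<otimes> b = \<one>" "(a \<otimes> b) \<otimes> (a \<otimes> b) = \<one>"
  shows "a \<otimes> b = b \<otimes> a"
proof -
  have "inv a = a" "inv b = b" "inv (a \<otimes> b) = a \<otimes> b"
    using assms by (auto intro!: inv_equality)
  then show ?thesis
    using inv_mult_group[OF assms(1,2)] by simp
qed

text \<open>The sets \<open>S\<close> and \<open>a\<^sup>-\<^sup>1 S\<close> both miss less than a quarter of \<open>G\<close>, so they overlap in more
  than half of it, and the image of every \<open>b\<close> in the overlap commutes with that of \<open>a\<close>.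
  Counting preimages in \<open>G\<close> instead of elements of square one in the image avoids comparing
  cardinalities in two groups.\<close>

lemma (in group_hom) image_central_if_square_in_kernel:
  defines "S \<equiv> {x \<in> carrier G. h (x \<otimes> x) = \<one>\<^bsub>H\<^esub>}"
  assumes fin: "finite (carrier G)" and big: "4 * card S > 3 * order G"
    and a: "a \<in> S" and g: "g \<in> carrier G"
  shows "h a \<otimes>\<^bsub>H\<^esub> h g = h g \<otimes>\<^bsub>H\<^esub> h a"
proof -
  let ?C = "{g \<in> carrier G. h a \<otimes>\<^bsub>H\<^esub> h g = h g \<otimes>\<^bsub>H\<^esub> h a}"
  let ?T = "(\<lambda>s. inv a \<otimes> s) ` S"
  have aG: "a \<in> carrier G" and SG: "S \<subseteq> carrier G"
    using a by (auto simp: S_def)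
  have TG: "?T \<subseteq> carrier G"
    using aG SG by auto
  have finS: "finite S" and finT: "finite ?T"
    using fin SG by (auto intro: finite_subset)
  have "inj_on (\<lambda>s. inv a \<otimes> s) S"
    using aG by (auto simp: S_def intro!: inj_onI)
  then have cardT: "card ?T = card S"
    by (rule card_image)
  have "card S + card ?T = card (S \<union> ?T) + card (S \<inter> ?T)"
    by (rule card_Un_Int[OF finS finT])
  moreover have "card (S \<union> ?T) \<le> order G"
    unfolding order_def using SG TG fin by (intro card_mono) auto
  ultimately have overlap: "2 * card (S \<inter> ?T) > order G"
    using big cardT by linarith
  have "S \<inter> ?T \<subseteq> ?C"
  proof
    fix b assume b: "b \<in> S \<inter> ?T"
    then obtain s where s: "s \<in> S" "b = inv a \<otimes> s" by auto
    then have "a \<otimes> b = s"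
      using aG SG by (auto simp: G.m_assoc[symmetric])
    with s have "a \<otimes> b \<in> S" by simp
    with a b have "h a \<otimes>\<^bsub>H\<^esub> h b = h b \<otimes>\<^bsub>H\<^esub> h a"
      by (intro H.commute_if_squares_eq_one) (auto simp: S_def)
    with b SG show "b \<in> ?C" by auto
  qed
  then have "card (S \<inter> ?T) \<le> card ?C"
    using fin by (intro card_mono) auto
  with overlap have "2 * card ?C > order G" by linarith
  then have "?C = carrier G"
    by (rule G.subgroup_eq_carrier_if_more_than_half[OF subgroup_commuting_image[OF aG] fin])
  with g show ?thesis by auto
qed

text \<open>Every \<open>x\<close> commutes, under \<open>h\<close>, with all of \<open>S\<close>, which is more than half of \<open>G\<close> and hence not
  contained in a proper subgroup. So the image of \<open>h\<close> is commutative, squaring is a homomorphism on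
  it, and \<open>S\<close> is itself a subgroup with more than half of the elements.\<close>

lemma (in group_hom) square_in_kernel_if_more_than_three_quarters:
  defines "S \<equiv> {x \<in> carrier G. h (x \<otimes> x) = \<one>\<^bsub>H\<^esub>}"
  assumes fin: "finite (carrier G)" and big: "4 * card S > 3 * order G"
  shows "S = carrier G"
proof -
  have SG: "S \<subseteq> carrier G"
    by (auto simp: S_def)
  have half: "2 * card S > order G"
    using big by linarith
  have comm: "h x \<otimes>\<^bsub>H\<^esub> h y = h y \<otimes>\<^bsub>H\<^esub> h x" if x: "x \<in> carrier G" and y: "y \<in> carrier G" for x y
  proof -
    let ?C = "{g \<in> carrier G. h x \<otimes>\<^bsub>H\<^esub> h g = h g \<otimes>\<^bsub>H\<^esub> h x}"
    have "S \<subseteq> ?C"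
      using image_central_if_square_in_kernel[OF fin big[unfolded S_def] _ x, symmetric]
      unfolding S_def by blast
    then have "card S \<le> card ?C"
      using fin by (intro card_mono) auto
    with half have "2 * card ?C > order G" by linarith
    then have "?C = carrier G"
      by (rule G.subgroup_eq_carrier_if_more_than_half[OF subgroup_commuting_image[OF x] fin])
    with y show ?thesis by auto
  qed
  have "subgroup S G"
  proof (rule G.subgroupI[OF SG])
    show "S \<noteq> {}" by (auto simp: S_def)
    show "inv a \<in> S" if "a \<in> S" for a
    proof -
      have a: "a \<in> carrier G" "h (a \<otimes> a) = \<one>\<^bsub>H\<^esub>"
        using that by (auto simp: S_def)
      have "h (inv a \<otimes> inv a) = h (inv (a \<otimes> a))"
        using a by (simp add: G.inv_mult_group)
      also have "\<dots> = \<one>\<^bsub>H\<^esub>"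
        using a by (metis G.m_closed H.inv_one hom_inv)
      finally show ?thesis
        using a by (simp add: S_def)
    qed
    show "a \<otimes> b \<in> S" if "a \<in> S" "b \<in> S" for a b
    proof -
      have a: "a \<in> carrier G" "h a \<otimes>\<^bsub>H\<^esub> h a = \<one>\<^bsub>H\<^esub>" and b: "b \<in> carrier G" "h b \<otimes>\<^bsub>H\<^esub> h b = \<one>\<^bsub>H\<^esub>"
        using that by (auto simp: S_def)
      have "h (a \<otimes> b \<otimes> (a \<otimes> b)) = h a \<otimes>\<^bsub>H\<^esub> (h b \<otimes>\<^bsub>H\<^esub> h a) \<otimes>\<^bsub>H\<^esub> h b"
        using a b by (simp add: H.m_assoc)
      also have "\<dots> = (h a \<otimes>\<^bsub>H\<^esub> h a) \<otimes>\<^bsub>H\<^esub> (h b \<otimes>\<^bsub>H\<^esub> h b)"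
        using a(1) b(1) comm[OF b(1) a(1)] by (simp add: H.m_assoc)
      also have "\<dots> = \<one>\<^bsub>H\<^esub>"
        using a b by simp
      finally show ?thesis
        using a b by (simp add: S_def)
    qed
  qed
  then show ?thesis
    by (rule G.subgroup_eq_carrier_if_more_than_half[OF _ fin half])
qed

section \<open>Central squares\<close>

text \<open>The kernel of the conjugation action is the center, so this action can stand in for the
  projection of \<open>G\<close> to its quotient by the center.\<close>

lemma (in group) conjugation_eq_one_iff:
  assumes z: "z \<in> carrier G"
  shows "(\<lambda>x \<in> carrier G. z \<otimes> x \<otimes> inv z) = \<one>\<^bsub>BijGroup (carrier G)\<^esub> \<longleftrightarrow>
         (\<forall>x \<in> carrier G. x \<otimes> z = z \<otimes> x)"
proof -
  have "(\<lambda>x \<in> carrier G. z \<otimes> x \<otimes> inv z) = \<one>\<^bsub>BijGroup (carrier G)\<^esub> \<longleftrightarrow>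
        (\<forall>x \<in> carrier G. z \<otimes> x \<otimes> inv z = x)"
    by (auto simp: BijGroup_def restrict_def fun_eq_iff)
  also have "\<dots> \<longleftrightarrow> (\<forall>x \<in> carrier G. x \<otimes> z = z \<otimes> x)"
    using z by (intro ball_cong refl) (auto simp: inv_solve_right')
  finally show ?thesis .
qed

lemma (in group) squares_central_if_more_than_three_quarters:
  defines "S \<equiv> {y \<in> carrier G. \<forall>x \<in> carrier G. x \<otimes> (y \<otimes> y) = y \<otimes> y \<otimes> x}"
  assumes fin: "finite (carrier G)" and big: "4 * card S > 3 * order G"
  shows "S = carrier G"
proof -
  let ?h = "\<lambda>g. \<lambda>x \<in> carrier G. g \<otimes> x \<otimes> inv g"
  have S_eq: "S = {y \<in> carrier G. ?h (y \<otimes> y) = \<one>\<^bsub>BijGroup (carrier G)\<^esub>}"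
  proof -
    have "?h (y \<otimes> y) = \<one>\<^bsub>BijGroup (carrier G)\<^esub> \<longleftrightarrow>
          (\<forall>x \<in> carrier G. x \<otimes> (y \<otimes> y) = y \<otimes> y \<otimes> x)" if "y \<in> carrier G" for y
      using that by (simp add: conjugation_eq_one_iff)
    then show ?thesis
      unfolding S_def by blast
  qed
  interpret group_hom G "BijGroup (carrier G)" ?h
    by (rule group_action.group_hom[OF action_by_conjugation])
  show ?thesis
    unfolding S_eq
    by (rule square_in_kernel_if_more_than_three_quarters[OF fin big[unfolded S_eq]])
qed

section \<open>Counting the solutions\<close>

text \<open>Twice the number of solutions is at most \<open>2 |S| |G| + (|G| - |S|) |G| = (|G| + |S|) |G|\<close>, where
  \<open>S\<close> is the set of elements with central square.\<close>

lemma (in group) card_commuting_with_square_le: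
  assumes fin: "finite (carrier G)"
    and noncentral: "\<exists>y \<in> carrier G. \<exists>x \<in> carrier G. x \<otimes> (y \<otimes> y) \<noteq> y \<otimes> y \<otimes> x"
  shows "8 * card (SIGMA y : carrier G. {x \<in> carrier G. x \<otimes> (y \<otimes> y) = y \<otimes> y \<otimes> x})
           \<le> 7 * (order G * order G)"
proof -
  let ?C = "\<lambda>y. {x \<in> carrier G. x \<otimes> (y \<otimes> y) = y \<otimes> y \<otimes> x}"
  define S where "S = {y \<in> carrier G. \<forall>x \<in> carrier G. x \<otimes> (y \<otimes> y) = y \<otimes> y \<otimes> x}"
  have SG: "S \<subseteq> carrier G" and finS: "finite S"
    using fin by (auto simp: S_def)
  have "S \<noteq> carrier G"
    using noncentral by (auto simp: S_def)
  then have S_le: "4 * card S \<le> 3 * order G"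
    using squares_central_if_more_than_three_quarters[OF fin] unfolding S_def
    by (metis (no_types, lifting) not_le)
  have all: "card (?C y) \<le> order G" for y
    unfolding order_def using fin by (intro card_mono) auto
  have half: "2 * card (?C y) \<le> order G" if "y \<in> carrier G - S" for y
    using that card_centralizer_le_half[OF fin, of "y \<otimes> y"] by (auto simp: S_def)
  have "2 * card (SIGMA y : carrier G. ?C y) = (\<Sum>y\<in>carrier G. 2 * card (?C y))"
    using fin by (simp add: card_SigmaI sum_distrib_left)
  also have "\<dots> = (\<Sum>y\<in>carrier G - S. 2 * card (?C y)) + (\<Sum>y\<in>S. 2 * card (?C y))"
    using SG fin by (rule sum.subset_diff)
  also have "\<dots> \<le> (\<Sum>y\<in>carrier G - S. order G) + (\<Sum>y\<in>S. 2 * order G)"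
    using half all by (intro add_mono sum_mono) auto
  also have "\<dots> = (card (carrier G - S) + 2 * card S) * order G"
    by (simp add: algebra_simps)
  also have "card (carrier G - S) + 2 * card S = order G + card S"
    using SG fin finS card_mono[OF fin SG] by (simp add: card_Diff_subset order_def)
  finally have "8 * card (SIGMA y : carrier G. ?C y) \<le> (4 * order G + 4 * card S) * order G"
    by (simp add: algebra_simps)
  also have "\<dots> \<le> (7 * order G) * order G"
    using S_le by (intro mult_right_mono) auto
  finally show ?thesis unfolding mult.assoc .
qed

lemma free_vars_commutes_with_square_eqn: "free_vars commutes_with_square_eqn = {0, 1}"
  unfolding commutes_with_square_eqn_def Let_def by auto

lemma satisfies_commutes_with_square_eqn:
  "satisfies G v commutes_with_square_eqn \<longleftrightarrow>
     v 0 \<otimes>\<^bsub>G\<^esub> (v 1 \<otimes>\<^bsub>G\<^esub> v 1) = v 1 \<otimes>\<^bsub>G\<^esub> v 1 \<otimes>\<^bsub>G\<^esub> v 0"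
  by (simp add: commutes_with_square_eqn_def Let_def)

lemma card_assignments_commutes_with_square_eqn:
  "card (assignments G commutes_with_square_eqn) = order G * order G"
  by (simp add: assignments_def free_vars_commutes_with_square_eqn card_PiE order_def)

text \<open>An assignment becomes the pair \<open>(y, x)\<close>, with the value of \<open>y\<close> (variable \<open>1\<close>) first, because
  the solutions are counted by summing over \<open>y\<close>.\<close>

lemma card_solutions_commutes_with_square_eqn_le:
  assumes fin: "finite (carrier G)"
  shows "card {v \<in> assignments G commutes_with_square_eqn. satisfies G v commutes_with_square_eqn}
    \<le> card (SIGMA y : carrier G. {x \<in> carrier G. x \<otimes>\<^bsub>G\<^esub> (y \<otimes>\<^bsub>G\<^esub> y) = y \<otimes>\<^bsub>G\<^esub> y \<otimes>\<^bsub>G\<^esub> x})"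
    (is "card ?V \<le> card ?P")
proof (rule card_inj_on_le)
  show "inj_on (\<lambda>v. (v 1, v 0)) ?V"
  proof (rule inj_onI)
    fix v w assume "v \<in> ?V" "w \<in> ?V" and eq: "(v 1, v 0) = (w 1, w 0)"
    then have "v \<in> {0, 1} \<rightarrow>\<^sub>E carrier G" "w \<in> {0, 1} \<rightarrow>\<^sub>E carrier G"
      by (simp_all add: assignments_def free_vars_commutes_with_square_eqn)
    then show "v = w"
      by (rule PiE_ext) (use eq in auto)
  qed
  show "(\<lambda>v. (v 1, v 0)) ` ?V \<subseteq> ?P"
    by (auto simp: assignments_def free_vars_commutes_with_square_eqn
        satisfies_commutes_with_square_eqn PiE_iff)
  show "finite ?P"
    using fin by auto
qed

theorem proposition2p5:
  "finite_satisfiability_gap TYPE('a) commutes_with_square_eqn (1 / 8)"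
  unfolding finite_satisfiability_gap_def
proof (intro conjI allI impI)
  fix G :: "'a monoid"
  assume "group G" and fin: "finite (carrier G)"
  interpret group G by fact
  let ?A = "assignments G commutes_with_square_eqn"
  let ?V = "{v \<in> ?A. satisfies G v commutes_with_square_eqn}"
  have pos: "order G > 0"
    using fin order_gt_0_iff_finite by simp
  show "degree_of_satisfiability G commutes_with_square_eqn = 1 \<or>
        degree_of_satisfiability G commutes_with_square_eqn \<le> 1 - 1 / 8"
  proof (cases "\<exists>y \<in> carrier G. \<exists>x \<in> carrier G.
      x \<otimes>\<^bsub>G\<^esub> (y \<otimes>\<^bsub>G\<^esub> y) \<noteq> y \<otimes>\<^bsub>G\<^esub> y \<otimes>\<^bsub>G\<^esub> x")
    case False
    have "satisfies G v commutes_with_square_eqn" if "v \<in> ?A" for v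
    proof -
      have "v 0 \<in> carrier G" "v 1 \<in> carrier G"
        using that by (auto simp: assignments_def free_vars_commutes_with_square_eqn)
      with False show ?thesis
        unfolding satisfies_commutes_with_square_eqn by blast
    qed
    then have "?V = ?A" by blast
    with pos show ?thesis
      by (simp add: degree_of_satisfiability_def card_assignments_commutes_with_square_eqn)
  next
    case True
    have "8 * card ?V \<le> 7 * card ?A"
      using card_commuting_with_square_le[OF fin True]
        card_solutions_commutes_with_square_eqn_le[OF fin]
      unfolding card_assignments_commutes_with_square_eqn by linarith
    then have "8 * real (card ?V) \<le> 7 * real (card ?A)"
      by linarith
    moreover have "real (card ?A) > 0"
      using pos by (simp add: card_assignments_commutes_with_square_eqn)
    ultimately show ?thesis
      unfolding degree_of_satisfiability_def by (simp add: field_simps)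
  qed
qed simp

end
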